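(* Let $n\ge1$, let $\lambda$ be an admitted vector of type $A_n$, let $1\le i<j\le n+1$, $\alpha:=e_i-e_j$, let $t:=s_{k,\ell}\in W(A_n)=S_{n+1}$ be the transposition exchanging $k$ and $\ell$, where $1\le k<\ell\le n+1$, and let $B_{i,j}:=B_{i,j}(k,\ell)$. Then $$(t\diamond\lambda)_{i,j}=\begin{cases}\lambda_{t(i),t(j)}-\displaystyle\int_i^j\gamma_t(\lambda,v)\,dv+|B_{i,j}| & \text{if }\alpha\notin N(t),\\[2mm] \lambda_{t(i),t(j)}-\displaystyle\int_i^j\gamma_t(\lambda,v)\,dv+|B_{i,j}|-1 & \text{if }\alpha\in N(t).\end{cases}$$
   Context: Let $W(A_n)=S_{n+1}$ act on $\mathbb{R}^{n+1}$ with canonical basis $e_1,\dots,e_{n+1}$ by $\sigma(e_i)=e_{\sigma(i)}$, and let $\Phi^+=\{e_i-e_j : 1\le i<j\le n+1\}$, $\Phi^-=-\Phi^+$. For $w\in W(A_n)$, the inversion set is $N(w)=\{\xi\in\Phi^+ : w^{-1}(\xi)\in\Phi^-\}$. Let $m=n(n+1)/2$ and index coordinates of $\mathbb{R}^m$ by pairs $(i,j)$, $1\le i<j\le n+1$. An admitted vector is a vector of integers $\lambda=(\lambda_{i,j})_{1\le i<j\le n+1}$ such that $\lambda_{i,i+1}=0$ for all $1\le i\le n$ and $\lambda_{i,j}+\lambda_{j,k}\le\lambda_{i,k}\le\lambda_{i,j}+\lambda_{j,k}+1$ for all $i<j<k$. Convention: for any vector $x\in\mathbb{R}^m$ (in particular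 for $\lambda$), $x_{b,a}:=-x_{a,b}$ for $a<b$. For an admitted vector $\lambda$, let $X_{W(\widetilde{A}_n)}[\lambda]=\{x\in\mathbb{R}^m : x_{i,j}=\sum_{r=i}^{j-1}x_{r,r+1}+\lambda_{i,j}\text{ for all }1\le i<j\le n+1\}$, and let $\widehat{X}_{W(\widetilde{A}_n)}=\bigsqcup_{\lambda\text{ admitted}}X_{W(\widetilde{A}_n)}[\lambda]$. The $\Phi^+$-representation (restricted to $W(A_n)$) is the homomorphism $F:W(A_n)\to\mathrm{Isom}(\mathbb{R}^m)$ given, for $i<j$, by $F(w)(x)_{i,j}=x_{w^{-1}(i),w^{-1}(j)}$ if $w^{-1}(i)<w^{-1}(j)$, and $F(w)(x)_{i,j}=-x_{w^{-1}(j),w^{-1}(i)}-1$ if $w^{-1}(i)>w^{-1}(j)$. It is known that each $F(w)$ permutes the sets $X_{W(\widetilde{A}_n)}[\lambda]$, $\lambda$ admitted. The action $\diamond$ of $W(A_n)$ on admitted vectors is defined by: $w\diamond\lambda$ is the admitted vector with $F(w)(X_{W(\widetilde{A}_n)}[\lambda])=X_{W(\widetilde{A}_n)}[w\diamond\lambda]$. For $i<j$: $B_{i,j}(k,\ell)=\{p\in\{i,\dots,j-1\} : e_p-e_{p+1}\in N(s_{k,\ell})\}$. For $w\in W(A_n)$, $x\in\widehat{X}_{W(\widetilde{A}_n)}$ and real $v\in[1,n+1)$, put $\gamma_w(x,v):=x_{w(\lfloor v\rfloor),w(\lfloor v+1\rfloor)}$, a step function of $v$ (the value at $v=n+1$ is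 irrelevant for integrals). Note that every admitted vector $\lambda$ is itself a point of $\widehat{X}_{W(\widetilde{A}_n)}$, so $\gamma_t(\lambda,v)$ makes sense. *)

theory Defs
  imports "HOL-Analysis.Analysis" "HOL-Combinatorics.Permutations"
begin

text \<open>
  The group $W(A_n) = S_{n+1}$ is the set of permutations of $\{1,\dots,n+1\}$, each extended
  by the identity to all of \<^typ>\<open>nat\<close>.  Vectors of $R^{n+1}$ are functions
  \<^typ>\<open>nat \<Rightarrow> real\<close> vanishing outside $\{1,\dots,n+1\}$.
\<close>

definition weyl_A :: "nat \<Rightarrow> (nat \<Rightarrow> nat) set" where
  "weyl_A n = {w. w permutes {1..n+1}}"

definition std_vec :: "nat \<Rightarrow> nat \<Rightarrow> real" where
  "std_vec i = (\<lambda>k. if k = i then 1 else 0)"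

text \<open>The linear action determined by \<open>\<sigma> (e\<^sub>i) = e\<^bsub>\<sigma> i\<^esub>\<close>; see \<open>perm_act_std_vec\<close>.\<close>

definition perm_act :: "(nat \<Rightarrow> nat) \<Rightarrow> (nat \<Rightarrow> real) \<Rightarrow> (nat \<Rightarrow> real)" where
  "perm_act w v = (\<lambda>k. v (inv w k))"

lemma perm_act_std_vec: "w \<in> weyl_A n \<Longrightarrow> perm_act w (std_vec i) = std_vec (w i)"
  by (auto simp: weyl_A_def perm_act_def std_vec_def fun_eq_iff permutes_inverses
      dest: permutes_inv_eq)

definition pos_roots :: "nat \<Rightarrow> (nat \<Rightarrow> real) set" where
  "pos_roots n = {std_vec i - std_vec j | i j. 1 \<le> i \<and> i < j \<and> j \<le> n + 1}"

definition neg_roots :: "nat \<Rightarrow> (nat \<Rightarrow> real) set" where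
  "neg_roots n = uminus ` pos_roots n"

definition inversion_set :: "nat \<Rightarrow> (nat \<Rightarrow> nat) \<Rightarrow> (nat \<Rightarrow> real) set" where
  "inversion_set n w = {\<xi> \<in> pos_roots n. perm_act (inv w) \<xi> \<in> neg_roots n}"

text \<open>
  The space $R^m$, $m = n(n+1)/2$, consists of the real functions on the index set
  \<open>idx n\<close>, extended by \<^term>\<open>undefined\<close> outside it (so that equality of vectors is equality
  of functions).
\<close>

definition idx :: "nat \<Rightarrow> (nat \<times> nat) set" where
  "idx n = {(i, j). 1 \<le> i \<and> i < j \<and> j \<le> n + 1}"

type_synonym pair_vec = "nat \<times> nat \<Rightarrow> real"

definition pair_space :: "nat \<Rightarrow> pair_vec set" where
  "pair_space n = idx n \<rightarrow>\<^sub>E UNIV"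

text \<open>
  The coordinate \<open>x\<^bsub>a,b\<^esub>\<close> for arbitrary \<open>a \<noteq> b\<close>, under the convention
  \<open>x\<^bsub>b,a\<^esub> = - x\<^bsub>a,b\<^esub>\<close>.  The value at \<open>a = b\<close> is never used.
\<close>

definition coord :: "pair_vec \<Rightarrow> nat \<Rightarrow> nat \<Rightarrow> real" where
  "coord x a b = (if a < b then x (a, b) else - x (b, a))"

definition admitted :: "nat \<Rightarrow> pair_vec \<Rightarrow> bool" where
  "admitted n lam \<longleftrightarrow>
     lam \<in> idx n \<rightarrow>\<^sub>E \<int> \<and>
     (\<forall>i. 1 \<le> i \<and> i \<le> n \<longrightarrow> lam (i, i + 1) = 0) \<and>
     (\<forall>i j k. 1 \<le> i \<and> i < j \<and> j < k \<and> k \<le> n + 1 \<longrightarrow>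
        lam (i, j) + lam (j, k) \<le> lam (i, k) \<and> lam (i, k) \<le> lam (i, j) + lam (j, k) + 1)"

definition X_comp :: "nat \<Rightarrow> pair_vec \<Rightarrow> pair_vec set" where
  "X_comp n lam = {x \<in> pair_space n. \<forall>(i, j) \<in> idx n.
     x (i, j) = (\<Sum>r = i..<j. x (r, r + 1)) + lam (i, j)}"

definition X_hat :: "nat \<Rightarrow> pair_vec set" where
  "X_hat n = (\<Union>lam \<in> {lam. admitted n lam}. X_comp n lam)"

lemma admitted_in_X_hat:
  assumes "admitted n lam"
  shows "lam \<in> X_hat n"
proof -
  have "(\<Sum>r = i..<j. lam (r, r + 1)) = 0" if "(i, j) \<in> idx n" for i j
    using assms that by (intro sum.neutral) (auto simp: admitted_def idx_def)
  moreover have "lam \<in> pair_space n"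
    using assms by (auto simp: admitted_def pair_space_def PiE_iff)
  ultimately have "lam \<in> X_comp n lam"
    by (auto simp: X_comp_def)
  with assms show ?thesis by (auto simp: X_hat_def)
qed

definition phi_rep :: "nat \<Rightarrow> (nat \<Rightarrow> nat) \<Rightarrow> pair_vec \<Rightarrow> pair_vec" where
  "phi_rep n w x = (\<lambda>(i, j) \<in> idx n.
     if inv w i < inv w j then x (inv w i, inv w j)
     else - x (inv w j, inv w i) - 1)"

definition diamond :: "nat \<Rightarrow> (nat \<Rightarrow> nat) \<Rightarrow> pair_vec \<Rightarrow> pair_vec" where
  "diamond n w lam = (THE \<mu>. admitted n \<mu> \<and> phi_rep n w ` X_comp n lam = X_comp n \<mu>)"

definition B_set :: "nat \<Rightarrow> nat \<Rightarrow> nat \<Rightarrow> nat \<Rightarrow> nat \<Rightarrow> nat set" where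
  "B_set n i j k l =
     {p \<in> {i..<j}. std_vec p - std_vec (p + 1) \<in> inversion_set n (Transposition.transpose k l)}"

text \<open>Meaningful for \<open>w \<in> weyl_A n\<close>, \<open>x \<in> X_hat n\<close> and \<open>1 \<le> v < n + 1\<close>.\<close>

definition gamma :: "(nat \<Rightarrow> nat) \<Rightarrow> pair_vec \<Rightarrow> real \<Rightarrow> real" where
  "gamma w x v = coord x (w (nat \<lfloor>v\<rfloor>)) (w (nat \<lfloor>v + 1\<rfloor>))"

end

theory Submission imports Defs begin

text \<open>
  Write \<open>L x a b\<close> for \<open>x\<^bsub>a,b\<^esub>\<close> if \<open>a < b\<close> and \<open>- x\<^bsub>b,a\<^esub> - 1\<close> otherwise, so that
  \<open>F(w)(x)\<^bsub>i,j\<^esub> = L x (w\<^sup>-\<^sup>1 i) (w\<^sup>-\<^sup>1 j)\<close>.  A point of \<open>X[\<lambda>]\<close> differs from \<open>\<lambda>\<close> by a coboundary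
  \<open>(a, b) \<mapsto> f b - f a\<close>, and \<open>F(w)\<close> turns this into the coboundary of \<open>f \<circ> w\<^sup>-\<^sup>1\<close>.
  Hence \<open>w \<diamond> \<lambda>\<close> is \<open>F(w)(\<lambda>)\<close> corrected by the unique coboundary that makes its simple
  coordinates vanish, i.e. its \<open>(i, j)\<close> coordinate is that of \<open>F(w)(\<lambda>)\<close> minus the sum of
  the simple ones between \<open>i\<close> and \<open>j\<close>.  The integral is the sum of the
  \<open>\<lambda>\<close>-parts of those simple coordinates, and \<open>|B|\<close> counts the occurrences of \<open>-1\<close> in them.
\<close>

section \<open>Coordinates of the representation and uniqueness of the label of a component\<close>

definition twisted_coord :: "pair_vec \<Rightarrow> nat \<Rightarrow> nat \<Rightarrow> real" where
  "twisted_coord x a b = (if a < b then x (a, b) else - x (b, a) - 1)"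

lemma twisted_coord_eq_coord:
  "a \<noteq> b \<Longrightarrow> twisted_coord x a b = coord x a b - of_bool (b < a)"
  by (auto simp: twisted_coord_def coord_def)

lemma phi_rep_apply:
  "(i, j) \<in> idx n \<Longrightarrow> phi_rep n w x (i, j) = twisted_coord x (inv w i) (inv w j)"
  by (simp add: phi_rep_def twisted_coord_def)

lemma admitted_sum_simple:
  "admitted n lam \<Longrightarrow> (i, j) \<in> idx n \<Longrightarrow> (\<Sum>r = i..<j. lam (r, r + 1)) = 0"
  by (intro sum.neutral) (auto simp: admitted_def idx_def)

lemma admitted_in_X_comp:
  assumes "admitted n lam" shows "lam \<in> X_comp n lam"
proof -
  have "lam \<in> pair_space n"
    using assms by (auto simp: admitted_def pair_space_def PiE_iff)
  with admitted_sum_simple[OF assms] show ?thesis by (auto simp: X_comp_def)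
qed

text \<open>The point \<open>lam\<close> of \<open>X_comp n lam\<close> has vanishing simple
  coordinates, so reading the equations of \<open>X_comp n mu\<close> at that point gives
  \<open>lam = mu\<close>. This settles uniqueness for the definite description in
  \<open>diamond\<close>.\<close>

lemma X_comp_inject:
  assumes "admitted n lam" "admitted n mu" "X_comp n lam = X_comp n mu"
  shows "lam = mu"
proof (rule PiE_ext)
  show "lam \<in> idx n \<rightarrow>\<^sub>E \<int>" "mu \<in> idx n \<rightarrow>\<^sub>E \<int>"
    using assms by (auto simp: admitted_def)
  fix p assume "p \<in> idx n"
  moreover have "lam \<in> X_comp n mu"
    using admitted_in_X_comp[OF assms(1)] assms(3) by simp
  ultimately show "lam p = mu p"
    using admitted_sum_simple[OF assms(1)] by (cases p) (force simp: X_comp_def)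
qed

lemma diamond_eqI:
  assumes "admitted n mu" "phi_rep n w ` X_comp n lam = X_comp n mu"
  shows "diamond n w lam = mu"
  unfolding diamond_def using assms X_comp_inject by (intro the_equality) auto

section \<open>Coboundaries, triangle inequalities and integrality\<close>

text \<open>When \<open>b < a\<close>, negating \<open>x (b, a)\<close> also reverses the increment
  of \<open>f\<close>, and the constant -1 is the same on both sides.\<close>

lemma twisted_coord_shift:
  assumes "\<And>a b. (a, b) \<in> idx n \<Longrightarrow> x (a, b) = f b - f a + lam (a, b)"
    and "a \<in> {1..n+1}" "b \<in> {1..n+1}" "a \<noteq> b"
  shows "twisted_coord x a b = f b - f a + twisted_coord lam a b"
  using assms(1)[of a b] assms(1)[of b a] assms(2-4)
  by (auto simp: twisted_coord_def idx_def)

lemma X_comp_coboundary: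
  assumes "x \<in> X_comp n lam" "(a, b) \<in> idx n"
  shows "x (a, b) = (\<Sum>r = 1..<b. x (r, r + 1)) - (\<Sum>r = 1..<a. x (r, r + 1)) + lam (a, b)"
proof -
  have "(\<Sum>r = 1..<b. x (r, r + 1)) = (\<Sum>r = 1..<a. x (r, r + 1)) + (\<Sum>r = a..<b. x (r, r + 1))"
    using assms(2) by (intro sum.atLeastLessThan_concat[symmetric]) (auto simp: idx_def)
  with assms show ?thesis by (auto simp: X_comp_def)
qed

text \<open>Simple coordinates of \<open>lam\<close> vanish, so those of \<open>x\<close> are the
  increments of \<open>f\<close> and their sums telescope. Any potential \<open>f\<close> will
  therefore do, which makes membership easy to check for images under
  \<open>phi_rep\<close>.\<close>

lemma coboundary_in_X_comp:
  assumes "admitted n lam" "x \<in> pair_space n"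
    and x: "\<And>a b. (a, b) \<in> idx n \<Longrightarrow> x (a, b) = f b - f a + lam (a, b)"
  shows "x \<in> X_comp n lam"
proof -
  have "x (a, b) = (\<Sum>r = a..<b. x (r, r + 1)) + lam (a, b)" if ab: "(a, b) \<in> idx n" for a b
  proof -
    have "(\<Sum>r = a..<b. x (r, r + 1)) = (\<Sum>r = a..<b. f (Suc r) - f r)"
      using assms(1) ab by (intro sum.cong) (auto simp: x idx_def admitted_def)
    also have "\<dots> = f b - f a"
      using ab by (intro sum_Suc_diff') (auto simp: idx_def)
    finally show ?thesis using x[OF ab] by simp
  qed
  with assms(2) show ?thesis by (auto simp: X_comp_def)
qed

text \<open>
  By antisymmetry up to \<open>-1\<close>, this says that the cyclic sum over \<open>a, b, c\<close> is \<open>-1\<close> or \<open>-2\<close>,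
  a condition invariant under all permutations of \<open>a, b, c\<close>.
\<close>

lemma twisted_coord_triangle:
  assumes "admitted n lam" "a \<in> {1..n+1}" "b \<in> {1..n+1}" "c \<in> {1..n+1}"
    and "a \<noteq> b" "b \<noteq> c" "a \<noteq> c"
  shows "twisted_coord lam a b + twisted_coord lam b c \<le> twisted_coord lam a c"
    and "twisted_coord lam a c \<le> twisted_coord lam a b + twisted_coord lam b c + 1"
proof -
  have tri: "lam (i, j) + lam (j, k) \<le> lam (i, k) \<and> lam (i, k) \<le> lam (i, j) + lam (j, k) + 1"
    if "1 \<le> i" "i < j" "j < k" "k \<le> n + 1" for i j k
    using assms(1) that by (auto simp: admitted_def)
  note tris = tri[of a b c] tri[of a c b] tri[of b a c] tri[of b c a] tri[of c a b] tri[of c b a]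
  show "twisted_coord lam a b + twisted_coord lam b c \<le> twisted_coord lam a c"
    and "twisted_coord lam a c \<le> twisted_coord lam a b + twisted_coord lam b c + 1"
    using tris assms(2-7) by (auto simp: twisted_coord_def split: if_splits)
qed

lemma admitted_Ints:
  "admitted n lam \<Longrightarrow> (a, b) \<in> idx n \<Longrightarrow> lam (a, b) \<in> \<int>"
  by (auto simp: admitted_def PiE_iff)

lemma twisted_coord_Ints:
  assumes "admitted n lam" "a \<in> {1..n+1}" "b \<in> {1..n+1}" "a \<noteq> b"
  shows "twisted_coord lam a b \<in> \<int>"
  using admitted_Ints[OF assms(1), of a b] admitted_Ints[OF assms(1), of b a] assms(2-)
  by (auto simp: twisted_coord_def idx_def)

section \<open>Explicit formula for the diamond action of an arbitrary permutation\<close>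

lemma diamond_apply:
  assumes w: "w permutes {1..n+1}" and lam: "admitted n lam" and ij: "(i, j) \<in> idx n"
  shows "diamond n w lam (i, j) = twisted_coord lam (inv w i) (inv w j)
           - (\<Sum>r = i..<j. twisted_coord lam (inv w r) (inv w (r + 1)))"
proof -
  define u where "u = inv w"
  define L where "L = (\<lambda>a b. twisted_coord lam (u a) (u b))"
  define mu where "mu = (\<lambda>(i, j) \<in> idx n. L i j - (\<Sum>r = i..<j. L r (r + 1)))"
  have u: "u permutes {1..n+1}" unfolding u_def by (rule permutes_inv[OF w])
  have u_in: "u a \<in> {1..n+1} \<longleftrightarrow> a \<in> {1..n+1}" for a by (rule permutes_in_image[OF u])
  have u_eq: "u a = u b \<longleftrightarrow> a = b" for a b using permutes_inj[OF u] by (auto dest: injD)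
  have wu: "w (u a) = a" for a unfolding u_def by (rule permutes_inverses(1)[OF w])
  have mu: "mu (a, b) = L a b - (\<Sum>r = a..<b. L r (r + 1))" if "(a, b) \<in> idx n" for a b
    using that by (simp add: mu_def)
  have L_Ints: "L a b \<in> \<int>" if "a \<in> {1..n+1}" "b \<in> {1..n+1}" "a \<noteq> b" for a b
    unfolding L_def using that u_in u_eq by (intro twisted_coord_Ints[OF lam]) auto
  have "admitted n mu"
    unfolding admitted_def
  proof (intro conjI allI impI)
    have "mu (a, b) \<in> \<int>" if "(a, b) \<in> idx n" for a b
      unfolding mu[OF that] using that
      by (intro Ints_diff Ints_sum L_Ints) (auto simp: idx_def)
    moreover have "mu p = undefined" if "p \<notin> idx n" for p
      using that by (simp add: mu_def)
    ultimately show "mu \<in> idx n \<rightarrow>\<^sub>E \<int>" by (auto simp: PiE_iff extensional_def)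
  next
    fix i assume "1 \<le> i \<and> i \<le> n"
    then show "mu (i, i + 1) = 0" by (subst mu) (auto simp: idx_def)
  next
    fix a b c assume abc: "1 \<le> a \<and> a < b \<and> b < c \<and> c \<le> n + 1"
    \<comment> \<open>The subtracted sums are additive over adjacent intervals, so the triangle
      inequalities for \<open>L\<close> pass unchanged to \<open>mu\<close>.\<close>
    have sum: "(\<Sum>r = a..<c. L r (r + 1)) = (\<Sum>r = a..<b. L r (r + 1)) + (\<Sum>r = b..<c. L r (r + 1))"
      using abc by (intro sum.atLeastLessThan_concat[symmetric]) auto
    have mus: "mu (a, b) = L a b - (\<Sum>r = a..<b. L r (r + 1))"
      "mu (b, c) = L b c - (\<Sum>r = b..<c. L r (r + 1))"
      "mu (a, c) = L a c - (\<Sum>r = a..<c. L r (r + 1))"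
      by (rule mu; use abc in \<open>simp add: idx_def\<close>)+
    have in_range: "u a \<in> {1..n+1}" "u b \<in> {1..n+1}" "u c \<in> {1..n+1}"
      "u a \<noteq> u b" "u b \<noteq> u c" "u a \<noteq> u c"
      unfolding u_in u_eq using abc by auto
    have L_triangle: "L a b + L b c \<le> L a c" "L a c \<le> L a b + L b c + 1"
      using twisted_coord_triangle[OF lam in_range] by (simp_all add: L_def)
    show "mu (a, b) + mu (b, c) \<le> mu (a, c)" "mu (a, c) \<le> mu (a, b) + mu (b, c) + 1"
      using L_triangle unfolding mus sum by linarith+
  qed
  moreover have "phi_rep n w ` X_comp n lam = X_comp n mu"
  proof (intro equalityI subsetI)
    fix y assume "y \<in> phi_rep n w ` X_comp n lam"
    then obtain x where x: "x \<in> X_comp n lam" and y: "y = phi_rep n w x" by blast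
    define f where "f a = (\<Sum>r = 1..<a. x (r, r + 1))" for a
    show "y \<in> X_comp n mu"
    proof (rule coboundary_in_X_comp[OF \<open>admitted n mu\<close>])
      show "y \<in> pair_space n" by (auto simp: y phi_rep_def pair_space_def)
      fix a b assume ab: "(a, b) \<in> idx n"
      have "y (a, b) = twisted_coord x (u a) (u b)"
        using ab by (simp add: y phi_rep_apply u_def)
      also have "\<dots> = f (u b) - f (u a) + L a b"
        unfolding L_def
      proof (rule twisted_coord_shift)
        show "x (a, b) = f b - f a + lam (a, b)" if "(a, b) \<in> idx n" for a b
          using X_comp_coboundary[OF x that] by (simp add: f_def)
        show "u a \<in> {1..n+1}" "u b \<in> {1..n+1}" "u a \<noteq> u b"
          unfolding u_in u_eq using ab by (auto simp: idx_def)
      qed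
      also have "L a b = mu (a, b) + (\<Sum>r = a..<b. L r (r + 1))" using mu[OF ab] by simp
      also have "(\<Sum>r = a..<b. L r (r + 1)) = (\<Sum>r = 1..<b. L r (r + 1)) - (\<Sum>r = 1..<a. L r (r + 1))"
        using ab sum.atLeastLessThan_concat[of 1 a b "\<lambda>r. L r (r + 1)"] by (auto simp: idx_def)
      \<comment> \<open>The potential that places \<open>y\<close> in \<open>X_comp n mu\<close> is
        that of \<open>x\<close> transported by \<open>u\<close>, plus the partial sums subtracted
        in \<open>mu\<close>.\<close>
      finally show "y (a, b) = (f (u b) + (\<Sum>r = 1..<b. L r (r + 1)))
          - (f (u a) + (\<Sum>r = 1..<a. L r (r + 1))) + mu (a, b)" by simp
    qed
  next
    fix y assume y: "y \<in> X_comp n mu"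
    \<comment> \<open>\<open>g\<close> is chosen so that \<open>g b - g a + L a b = y (a, b)\<close>
      on \<open>idx n\<close>. The preimage \<open>x\<close> uses \<open>g\<close> after
      \<open>w\<close>, since \<open>phi_rep\<close> composes with \<open>u\<close> and
      \<open>w (u a) = a\<close>.\<close>
    define g where "g a = (\<Sum>r = 1..<a. y (r, r + 1) - L r (r + 1))" for a
    define x where "x = (\<lambda>(a, b) \<in> idx n. g (w b) - g (w a) + lam (a, b))"
    have x: "x (a, b) = g (w b) - g (w a) + lam (a, b)" if "(a, b) \<in> idx n" for a b
      using that by (simp add: x_def)
    have "x \<in> X_comp n lam"
    proof (rule coboundary_in_X_comp[OF lam])
      show "x \<in> pair_space n" by (auto simp: x_def pair_space_def)
    qed (rule x)
    moreover have "phi_rep n w x = y"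
    proof (rule PiE_ext)
      show "phi_rep n w x \<in> idx n \<rightarrow>\<^sub>E UNIV" by (auto simp: phi_rep_def)
      show "y \<in> idx n \<rightarrow>\<^sub>E UNIV" using y by (auto simp: X_comp_def pair_space_def)
      fix p assume "p \<in> idx n"
      then obtain a b where p: "p = (a, b)" and ab: "(a, b) \<in> idx n" by (cases p) auto
      have "phi_rep n w x (a, b) = twisted_coord x (u a) (u b)"
        using ab by (simp add: phi_rep_apply u_def)
      also have "\<dots> = g (w (u b)) - g (w (u a)) + L a b"
        unfolding L_def
      proof (rule twisted_coord_shift[where f = "\<lambda>a. g (w a)"])
        show "x (a, b) = g (w b) - g (w a) + lam (a, b)" if "(a, b) \<in> idx n" for a b
          using that by (rule x)
        show "u a \<in> {1..n+1}" "u b \<in> {1..n+1}" "u a \<noteq> u b"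
          unfolding u_in u_eq using ab by (auto simp: idx_def)
      qed
      also have "\<dots> = g b - g a + L a b" by (simp add: wu)
      also have "g b - g a = (\<Sum>r = a..<b. y (r, r + 1) - L r (r + 1))"
        using ab sum.atLeastLessThan_concat[of 1 a b "\<lambda>r. y (r, r + 1) - L r (r + 1)"]
        by (auto simp: g_def idx_def)
      also have "\<dots> + L a b = (\<Sum>r = a..<b. y (r, r + 1)) + mu (a, b)"
        using mu[OF ab] by (simp add: sum_subtractf)
      also have "\<dots> = y (a, b)" using y ab by (auto simp: X_comp_def)
      finally show "phi_rep n w x p = y p" by (simp add: p)
    qed
    ultimately show "y \<in> phi_rep n w ` X_comp n lam" by blast
  qed
  ultimately have "diamond n w lam = mu" by (rule diamond_eqI)
  with mu[OF ij] show ?thesis by (simp add: L_def u_def)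
qed

section \<open>Inversions in terms of indices\<close>

text \<open>As \<open>a \<noteq> b\<close>, the difference takes the value 1 only at
  \<open>a\<close> and -1 only at \<open>b\<close>, so it determines both indices.\<close>

lemma std_vec_diff_inject:
  assumes "std_vec a - std_vec b = std_vec c - std_vec d" "a \<noteq> b"
  shows "a = c \<and> b = d"
proof -
  have "std_vec a m - std_vec b m = std_vec c m - std_vec d m" for m
    using fun_cong[OF assms(1), of m] by simp
  from this[of a] this[of b] show ?thesis
    using assms(2) by (auto simp: std_vec_def split: if_splits)
qed

text \<open>The action of \<open>inv w\<close> replaces the indices of the root by
  \<open>inv w i\<close> and \<open>inv w j\<close>, whose order decides its sign.\<close>

lemma inversion_set_iff:
  assumes w: "w permutes {1..n+1}" and ij: "(i, j) \<in> idx n"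
  shows "std_vec i - std_vec j \<in> inversion_set n w \<longleftrightarrow> inv w j < inv w i"
proof -
  have u: "inv w permutes {1..n+1}" by (rule permutes_inv[OF w])
  have in_range: "inv w i \<in> {1..n+1}" "inv w j \<in> {1..n+1}"
    unfolding permutes_in_image[OF u] using ij by (auto simp: idx_def)
  have "inv w i \<noteq> inv w j"
    using ij permutes_inj[OF u] by (auto simp: idx_def dest: injD)
  have "perm_act (inv w) (std_vec i - std_vec j)
      = perm_act (inv w) (std_vec i) - perm_act (inv w) (std_vec j)"
    by (simp add: perm_act_def fun_eq_iff)
  also have "\<dots> = std_vec (inv w i) - std_vec (inv w j)"
    using u perm_act_std_vec[of "inv w" n] by (simp add: weyl_A_def)
  finally have act: "perm_act (inv w) (std_vec i - std_vec j) = std_vec (inv w i) - std_vec (inv w j)" .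
  have "std_vec (inv w i) - std_vec (inv w j) \<in> neg_roots n \<longleftrightarrow> inv w j < inv w i"
  proof
    assume "std_vec (inv w i) - std_vec (inv w j) \<in> neg_roots n"
    then obtain a b where "a < b"
      and "std_vec (inv w i) - std_vec (inv w j) = - (std_vec a - std_vec b)"
      unfolding neg_roots_def pos_roots_def by blast
    then have "std_vec (inv w i) - std_vec (inv w j) = std_vec b - std_vec a"
      by (simp add: fun_eq_iff)
    with \<open>a < b\<close> show "inv w j < inv w i"
      using std_vec_diff_inject \<open>inv w i \<noteq> inv w j\<close> by metis
  next
    assume "inv w j < inv w i"
    then have "std_vec (inv w j) - std_vec (inv w i) \<in> pos_roots n"
      using in_range by (auto simp: pos_roots_def)
    then have "- (std_vec (inv w j) - std_vec (inv w i)) \<in> neg_roots n"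
      unfolding neg_roots_def by (rule imageI)
    moreover have "- (std_vec (inv w j) - std_vec (inv w i)) = std_vec (inv w i) - std_vec (inv w j)"
      by (simp add: fun_eq_iff)
    ultimately show "std_vec (inv w i) - std_vec (inv w j) \<in> neg_roots n" by simp
  qed
  then show ?thesis using ij act by (auto simp: inversion_set_def pos_roots_def idx_def)
qed

section \<open>The integral as a finite sum\<close>

lemma has_integral_floor_step:
  fixes h :: "nat \<Rightarrow> real"
  assumes "i \<le> j"
  shows "((\<lambda>v. h (nat \<lfloor>v\<rfloor>)) has_integral (\<Sum>r = i..<j. h r)) {real i..real j}"
  using assms
proof (induction j rule: dec_induct)
  case base
  then show ?case using has_integral_refl(2)[of _ "real i"] by simp
next
  case (step m)
  have "((\<lambda>v. h m) has_integral h m) {real m..real (Suc m)}"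
    using has_integral_const_real[of "h m" "real m" "real (Suc m)"] by simp
  then have "((\<lambda>v. h (nat \<lfloor>v\<rfloor>)) has_integral h m) {real m..real (Suc m)}"
  \<comment> \<open>The floor jumps at the right end of the unit interval; this single point does
    not affect the integral.\<close>
  proof (rule has_integral_spike_finite[of "{real (Suc m)}", rotated 2])
    fix v assume "v \<in> {real m..real (Suc m)} - {real (Suc m)}"
    then have "\<lfloor>v\<rfloor> = int m" by (intro floor_unique) auto
    then show "h (nat \<lfloor>v\<rfloor>) = h m" by simp
  qed simp
  with step show ?case by (auto intro!: has_integral_combine[of _ "real m"])
qed

lemma integral_gamma:
  assumes "i \<le> j"
  shows "integral {real i..real j} (gamma w x) = (\<Sum>r = i..<j. coord x (w r) (w (r + 1)))"
proof (rule integral_unique)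
  \<comment> \<open>\<open>nat\<close> truncates negative floors, so it commutes with adding 1 only
    because \<open>v\<close> is nonnegative.\<close>
  have "gamma w x v = coord x (w (nat \<lfloor>v\<rfloor>)) (w (nat \<lfloor>v\<rfloor> + 1))" if "real i \<le> v" for v
  proof -
    have "0 \<le> \<lfloor>v\<rfloor>" using that by simp
    then have "nat \<lfloor>v + 1\<rfloor> = nat \<lfloor>v\<rfloor> + 1" by (simp add: nat_add_distrib)
    then show ?thesis by (simp add: gamma_def)
  qed
  then show "(gamma w x has_integral (\<Sum>r = i..<j. coord x (w r) (w (r + 1)))) {real i..real j}"
    by (intro has_integral_eq[OF _ has_integral_floor_step[OF assms]]) auto
qed

section \<open>Specialization to a transposition\<close>

theorem theorem3p1:
  fixes n i j k l :: nat and lam :: pair_vec and t :: "nat \<Rightarrow> nat" and \<alpha> :: "nat \<Rightarrow> real"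
  assumes "n \<ge> 1"
    and "admitted n lam"
    and "1 \<le> i" and "i < j" and "j \<le> n + 1"
    and "\<alpha> = std_vec i - std_vec j"
    and "1 \<le> k" and "k < l" and "l \<le> n + 1"
    and "t = Transposition.transpose k l"
  shows "diamond n t lam (i, j) =
    (if \<alpha> \<notin> inversion_set n t
     then coord lam (t i) (t j) - integral {real i..real j} (\<lambda>v. gamma t lam v)
            + real (card (B_set n i j k l))
     else coord lam (t i) (t j) - integral {real i..real j} (\<lambda>v. gamma t lam v)
            + real (card (B_set n i j k l)) - 1)"
proof -
  have t: "t permutes {1..n+1}"
    unfolding assms(10) using assms by (intro permutes_swap_id) auto
  have inv_t: "inv t = t" by (simp add: assms(10))
  have t_eq: "t a = t b \<longleftrightarrow> a = b" for a b using permutes_inj[OF t] by (auto dest: injD)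
  have ij: "(i, j) \<in> idx n" using assms by (simp add: idx_def)
  have simple: "(r, r + 1) \<in> idx n" if "r \<in> {i..<j}" for r
    using that assms by (auto simp: idx_def)
  have B: "B_set n i j k l = {r \<in> {i..<j}. t (r + 1) < t r}"
    unfolding B_set_def assms(10)[symmetric]
    using inversion_set_iff[OF t simple] by (auto simp: inv_t)
  have "diamond n t lam (i, j)
      = twisted_coord lam (t i) (t j) - (\<Sum>r = i..<j. twisted_coord lam (t r) (t (r + 1)))"
    using diamond_apply[OF t assms(2) ij] by (simp add: inv_t)
  also have "(\<Sum>r = i..<j. twisted_coord lam (t r) (t (r + 1)))
      = (\<Sum>r = i..<j. coord lam (t r) (t (r + 1)) - of_bool (t (r + 1) < t r))"
    by (intro sum.cong refl twisted_coord_eq_coord) (simp add: t_eq)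
  also have "\<dots> = integral {real i..real j} (gamma t lam) - real (card (B_set n i j k l))"
    using assms(4) by (simp add: integral_gamma sum_subtractf B Int_def)
  \<comment> \<open>This \<open>of_bool\<close> is the indicator of \<open>\<alpha>\<close> in
    \<open>inversion_set n t\<close>, hence the extra -1 in the second case.\<close>
  also have "twisted_coord lam (t i) (t j) = coord lam (t i) (t j) - of_bool (t j < t i)"
    using assms(4) by (intro twisted_coord_eq_coord) (simp add: t_eq)
  finally show ?thesis
    using inversion_set_iff[OF t ij] by (simp add: assms(6) inv_t)
qed

end
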